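(* Let $X=\{X_1,\ldots,X_m\}$ be a family of linearly independent smooth vector fields on $\mathbb{R}^n$ satisfying (H.1) and (H.2) (see context), let $\Omega\subseteq\mathbb{R}^n$ be a bounded open set, regular for the Divergence Theorem, and let $\mathcal{F}=\mathcal{F}(x,z,p):\Omega\times\mathbb{R}\times\mathbb{R}^m\to\mathbb{R}$ satisfy (P.1) and (P.2) (see context). Then for every $u\in C^2(\overline{\Omega})$, $$ \begin{aligned} &\int_{\Omega}\big(q\,\mathcal{F}-\langle \mathcal{F}_p,\nabla_X u\rangle\big)\,dx+\int_{\Omega}\sum_{i=1}^n\sigma_i x_i\,(\partial_{x_i}\mathcal{F})\big(x,u(x),\nabla_X u(x)\big)\,dx\\ &\qquad+\int_{\Omega}\mathrm{T}u\,\big(\mathrm{div}_X(\mathcal{F}_p)+\partial_z\mathcal{F}\big)\,dx\\ &\quad=\int_{\partial\Omega}\mathcal{F}\,\langle \mathrm{T}(x),\nu\rangle\,dH^{n-1}-\int_{\partial\Omega}\mathrm{T}u\,\langle\mathcal{F}_p,\nu_X\rangle\,dH^{n-1}, \end{aligned} $$ where $\mathcal{F}$, $\partial_z\mathcal{F}$, $\mathcal{F}_p=(\partial_{p_1}\mathcal{F},\ldots,\partial_{p_m}\mathcal{F})$ are evaluated at $(x,u(x),\nabla_X u(x))$, and $\mathrm{div}_X(\mathcal{F}_p)$ is the $X$-divergence of the map $x\mapsto\mathcal{F}_p(x,u(x),\nabla_Xu(x))$.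
   Context: Assumptions on the vector fields. $X_1,\ldots,X_m$ are smooth vector fields on $\mathbb{R}^n$, linearly independent (as elements of the real vector space of smooth vector fields), such that: (H.1) $X_1,\ldots,X_m$ are homogeneous of degree $1$ with respect to a family of dilations $\delta_\lambda(x)=(\lambda^{\sigma_1}x_1,\ldots,\lambda^{\sigma_n}x_n)$, $\lambda>0$, where $\sigma_1,\ldots,\sigma_n\in\mathbb{N}$ and $1=\sigma_1\le\cdots\le\sigma_n$; that is, $X_i(u\circ\delta_\lambda)=\lambda\,(X_iu)\circ\delta_\lambda$ for all $u\in C^\infty(\mathbb{R}^n)$, $\lambda>0$ and $i=1,\ldots,m$. (H.2) Hörmander's condition at $0$: $\dim\{Y(0):Y\in\mathrm{Lie}(X)\}=n$, where $\mathrm{Lie}(X)$ is the smallest Lie subalgebra of the smooth vector fields on $\mathbb{R}^n$ containing $X$. For a vector field $Y=\sum_i a_i(x)\partial_{x_i}$, $Y(x)$ denotes the vector $(a_1(x),\ldots,a_n(x))\in\mathbb{R}^n$. Notation. $q:=\sum_{k=1}^n\sigma_k$. $\mathrm{T}:=\sum_{i=1}^n\sigma_i x_i\partial_{x_i}$ (the infinitesimal generator of the dilations), so $\mathrm{T}(x)=(\sigma_1x_1,\ldots,\sigma_nx_n)$. $\nabla_Xu=(X_1u,\ldots,X_mu)$. For $V=(V_1,\ldots,V_m)$ of class $C^1$, $\mathrm{div}_XV:=-\sum_{i=1}^mX_iV_i$ (note the minus sign). $H^{n-1}$ is the $(n-1)$-dimensional Hausdorff measure, $\nu$ is the outward unit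 normal to $\partial\Omega$, and $\nu_X:=(\langle X_1(x),\nu\rangle,\ldots,\langle X_m(x),\nu\rangle)$. "Regular for the Divergence Theorem" has its usual meaning: $H^{n-1}(\partial\Omega)<\infty$, the outward unit normal $\nu$ is defined $H^{n-1}$-a.e. on $\partial\Omega$, and $\int_\Omega\mathrm{div}\,V\,dx=\int_{\partial\Omega}\langle V,\nu\rangle\,dH^{n-1}$ for all $V\in C^1(\overline\Omega;\mathbb{R}^n)$. Assumptions on $\mathcal{F}$, with $\mathcal{D}:=\Omega\times\mathbb{R}\times\mathbb{R}^m$: (P.1) $\mathcal{F}$ is of class $C^1$ on (an open neighborhood of) $\overline{\mathcal{D}}$; (P.2) for every $i=1,\ldots,m$, $\partial_{p_i}\mathcal{F}$ is of class $C^1$ on $\overline{\mathcal{D}}$. *)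

theory Defs
  imports "HOL-Analysis.Analysis"
begin

section \<open>Functions of class $C^k$\<close>

(* For open U. Frechet differentiability together with continuity of the partial
   derivatives is the same as existence and continuity of the partial derivatives. *)
primrec Ck_on :: "nat \<Rightarrow> 'a::euclidean_space set \<Rightarrow> ('a \<Rightarrow> 'b::real_normed_vector) \<Rightarrow> bool" where
  "Ck_on 0 U f \<longleftrightarrow> continuous_on U f"
| "Ck_on (Suc k) U f \<longleftrightarrow>
     (\<forall>x\<in>U. f differentiable (at x)) \<and>
     (\<forall>b\<in>Basis. Ck_on k U (\<lambda>x. frechet_derivative f (at x) b))"

(* C^k on the closure of S means C^k on some open neighbourhood of the closure. *)
definition Ck_closure :: "nat \<Rightarrow> 'a::euclidean_space set \<Rightarrow> ('a \<Rightarrow> 'b::real_normed_vector) \<Rightarrow> bool" where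
  "Ck_closure k S f \<longleftrightarrow> (\<exists>U. open U \<and> closure S \<subseteq> U \<and> Ck_on k U f)"

definition smooth :: "('a::euclidean_space \<Rightarrow> 'b::real_normed_vector) \<Rightarrow> bool" where
  "smooth f \<longleftrightarrow> (\<forall>k. Ck_on k UNIV f)"

definition partial :: "'n \<Rightarrow> (real^'n::finite \<Rightarrow> real) \<Rightarrow> real^'n \<Rightarrow> real" where
  "partial i f x = frechet_derivative f (at x) (axis i 1)"


section \<open>Vector fields\<close>

(* A vector field is identified with its coefficient map x |-> (a_1 x, ..., a_n x);
   vf_apply is its action on functions as a first-order differential operator. *)
type_synonym 'n vfield = "real^'n \<Rightarrow> real^'n"

definition vf_apply :: "('n::finite) vfield \<Rightarrow> (real^'n \<Rightarrow> real) \<Rightarrow> real^'n \<Rightarrow> real" where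
  "vf_apply Y f x = (\<Sum>j\<in>UNIV. Y x $ j * partial j f x)"

(* Coefficient map of the commutator Y Z - Z Y. *)
definition lie_bracket :: "('n::finite) vfield \<Rightarrow> 'n vfield \<Rightarrow> 'n vfield" where
  "lie_bracket Y Z x = (\<chi> j. vf_apply Y (\<lambda>y. Z y $ j) x - vf_apply Z (\<lambda>y. Y y $ j) x)"

definition lie_subalgebra :: "('n::finite) vfield set \<Rightarrow> bool" where
  "lie_subalgebra L \<longleftrightarrow>
     (\<forall>Y\<in>L. smooth Y) \<and>
     (\<lambda>x. 0) \<in> L \<and>
     (\<forall>Y\<in>L. \<forall>Z\<in>L. (\<lambda>x. Y x + Z x) \<in> L) \<and>
     (\<forall>c. \<forall>Y\<in>L. (\<lambda>x. c *\<^sub>R Y x) \<in> L) \<and>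
     (\<forall>Y\<in>L. \<forall>Z\<in>L. lie_bracket Y Z \<in> L)"

definition Lie :: "('n::finite) vfield set \<Rightarrow> 'n vfield set" where
  "Lie A = lie_subalgebra hull A"

(* Linear independence over the reals in the vector space of vector fields
   (not pointwise linear independence). *)
definition vf_independent :: "('m::finite \<Rightarrow> ('n::finite) vfield) \<Rightarrow> bool" where
  "vf_independent X \<longleftrightarrow>
     (\<forall>c. (\<forall>x. (\<Sum>i\<in>UNIV. c i *\<^sub>R X i x) = 0) \<longrightarrow> (\<forall>i. c i = 0))"

definition dilation :: "('n::finite \<Rightarrow> nat) \<Rightarrow> real \<Rightarrow> real^'n \<Rightarrow> real^'n" where
  "dilation \<sigma> l x = (\<chi> i. l ^ \<sigma> i * x $ i)"

definition homogeneous_degree_one :: "('n::finite \<Rightarrow> nat) \<Rightarrow> 'n vfield \<Rightarrow> bool" where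
  "homogeneous_degree_one \<sigma> Y \<longleftrightarrow>
     (\<forall>u l. smooth u \<longrightarrow> l > 0 \<longrightarrow>
        (\<forall>x. vf_apply Y (u \<circ> dilation \<sigma> l) x = l * vf_apply Y u (dilation \<sigma> l x)))"

definition hoermander_at_0 :: "('m::finite \<Rightarrow> ('n::finite) vfield) \<Rightarrow> bool" where
  "hoermander_at_0 X \<longleftrightarrow> dim {Y 0 | Y. Y \<in> Lie (range X)} = CARD('n)"

definition dil_generator :: "('n::finite \<Rightarrow> nat) \<Rightarrow> 'n vfield" where
  "dil_generator \<sigma> x = (\<chi> i. real (\<sigma> i) * x $ i)"

definition X_grad :: "('m::finite \<Rightarrow> ('n::finite) vfield) \<Rightarrow> (real^'n \<Rightarrow> real) \<Rightarrow> real^'n \<Rightarrow> real^'m" where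
  "X_grad X u x = (\<chi> i. vf_apply (X i) u x)"

(* The minus sign is part of the convention. *)
definition X_div :: "('m::finite \<Rightarrow> ('n::finite) vfield) \<Rightarrow> (real^'n \<Rightarrow> real^'m) \<Rightarrow> real^'n \<Rightarrow> real" where
  "X_div X V x = - (\<Sum>i\<in>UNIV. vf_apply (X i) (\<lambda>y. V y $ i) x)"

definition divergence :: "(real^'n::finite \<Rightarrow> real^'n) \<Rightarrow> real^'n \<Rightarrow> real" where
  "divergence V x = (\<Sum>i\<in>UNIV. partial i (\<lambda>y. V y $ i) x)"


section \<open>Hausdorff measure\<close>

(* With k a natural number, 0 ^ 0 = 1, so that for k = 0 a singleton has size 1.
   The factor unit_ball_vol k normalises the k-dimensional measure so that it agrees
   with Lebesgue measure on k-dimensional planes. *)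
definition hausdorff_size :: "nat \<Rightarrow> 'a::metric_space set \<Rightarrow> ennreal" where
  "hausdorff_size k C =
     (if C = {} then 0 else ennreal (unit_ball_vol (real k) * (diameter C / 2) ^ k))"

(* The library gives unbounded sets a junk diameter, hence the boundedness condition. *)
definition hausdorff_premeasure :: "nat \<Rightarrow> real \<Rightarrow> 'a::metric_space set \<Rightarrow> ennreal" where
  "hausdorff_premeasure k d S =
     (INF C\<in>{C :: nat \<Rightarrow> 'a set. S \<subseteq> (\<Union>j. C j) \<and> (\<forall>j. bounded (C j) \<and> diameter (C j) \<le> d)}.
        \<Sum>j. hausdorff_size k (C j))"

definition hausdorff_outer :: "nat \<Rightarrow> 'a::metric_space set \<Rightarrow> ennreal" where
  "hausdorff_outer k S = (SUP d\<in>{0<..}. hausdorff_premeasure k d S)"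

(* hausdorff_outer is a metric outer measure, hence countably additive on Borel sets,
   so this measure has it as its emeasure there. *)
definition hausdorff_measure :: "nat \<Rightarrow> 'a::metric_space measure" where
  "hausdorff_measure k = measure_of UNIV (sets borel) (hausdorff_outer k)"

definition surface_measure :: "(real^'n::finite) measure" where
  "surface_measure = hausdorff_measure (CARD('n) - 1)"


section \<open>Divergence theorem\<close>

(* The outward unit normal in Federer's measure-theoretic sense; it is unique when it
   exists and coincides with the classical one near any point where the boundary is a
   C^1 hypersurface with the set on one side. *)
definition is_outward_normal :: "(real^'n::finite) set \<Rightarrow> real^'n \<Rightarrow> real^'n \<Rightarrow> bool" where
  "is_outward_normal \<Omega> x v \<longleftrightarrow>
     norm v = 1 \<and>
     ((\<lambda>r. measure lebesgue {y \<in> ball x r. y \<in> \<Omega> \<and> (y - x) \<bullet> v > 0} / r ^ CARD('n)) \<longlongrightarrow> 0) (at_right 0) \<and>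
     ((\<lambda>r. measure lebesgue {y \<in> ball x r. y \<notin> \<Omega> \<and> (y - x) \<bullet> v < 0} / r ^ CARD('n)) \<longlongrightarrow> 0) (at_right 0)"

definition outward_normal :: "(real^'n::finite) set \<Rightarrow> real^'n \<Rightarrow> real^'n" where
  "outward_normal \<Omega> x = (THE v. is_outward_normal \<Omega> x v)"

definition divergence_regular :: "(real^'n::finite) set \<Rightarrow> bool" where
  "divergence_regular \<Omega> \<longleftrightarrow>
     emeasure surface_measure (frontier \<Omega>) < \<infinity> \<and>
     (AE x\<in>frontier \<Omega> in surface_measure. \<exists>v. is_outward_normal \<Omega> x v) \<and>
     (\<forall>V. Ck_closure 1 \<Omega> V \<longrightarrow>
        (LINT x:\<Omega>|lborel. divergence V x) =
        (LINT x:frontier \<Omega>|surface_measure. V x \<bullet> outward_normal \<Omega> x))"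

definition X_normal :: "('m::finite \<Rightarrow> ('n::finite) vfield) \<Rightarrow> (real^'n) set \<Rightarrow> real^'n \<Rightarrow> real^'m" where
  "X_normal X \<Omega> x = (\<chi> i. X i x \<bullet> outward_normal \<Omega> x)"


section \<open>Lagrangians\<close>

type_synonym ('n, 'm) lagrangian = "(real^'n) \<times> real \<times> (real^'m) \<Rightarrow> real"

definition d_x :: "'n \<Rightarrow> ('n::finite, 'm::finite) lagrangian \<Rightarrow> ('n, 'm) lagrangian" where
  "d_x i F w = frechet_derivative F (at w) (axis i 1, 0, 0)"

definition d_z :: "('n::finite, 'm::finite) lagrangian \<Rightarrow> ('n, 'm) lagrangian" where
  "d_z F w = frechet_derivative F (at w) (0, 1, 0)"

definition d_p :: "'m \<Rightarrow> ('n::finite, 'm::finite) lagrangian \<Rightarrow> ('n, 'm) lagrangian" where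
  "d_p i F w = frechet_derivative F (at w) (0, 0, axis i 1)"

definition grad_p :: "('n::finite, 'm::finite) lagrangian \<Rightarrow> (real^'n) \<times> real \<times> (real^'m) \<Rightarrow> real^'m" where
  "grad_p F w = (\<chi> i. d_p i F w)"

definition X_jet :: "('m::finite \<Rightarrow> ('n::finite) vfield) \<Rightarrow> (real^'n \<Rightarrow> real) \<Rightarrow> real^'n \<Rightarrow> (real^'n) \<times> real \<times> (real^'m)" where
  "X_jet X u x = (x, u x, X_grad X u x)"

end

theory Submission
  imports Defs
begin

text \<open>
  The identity is the divergence theorem for the flux
  \<open>F T - (T u) \<Sum>\<^sub>i (\<partial>F/\<partial>p\<^sub>i) X\<^sub>i\<close>, where \<open>T\<close> is the generator of the
  dilations and \<open>F\<close> and its derivatives are evaluated along \<open>(x, u, X\<^sub>1 u, \<dots>, X\<^sub>m u)\<close>.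
  Three facts identify its divergence with the sum of the volume integrands
  (lemma \<open>dilation_flux_divergence\<close>).

  The divergence of \<open>T\<close> is the homogeneous dimension \<open>\<Sum>\<^sub>k \<sigma> k\<close>.

  The fields \<open>X\<^sub>i\<close> are divergence free (lemma \<open>homogeneous_diagonal_partial_eq_0\<close>), since
  \<open>\<partial>\<^sub>j\<close> of the \<open>j\<close>-th coefficient is continuous and homogeneous of degree \<open>-1\<close>.

  The commutator \<open>[X\<^sub>i, T]\<close> is \<open>X\<^sub>i\<close> (lemma \<open>dil_generator_commutator\<close>), by Euler's
  identity for the coefficients of \<open>X\<^sub>i\<close> and the symmetry of the second derivatives of \<open>u\<close>
  (lemma \<open>partial_commute\<close>). Hence, when \<open>T\<close> differentiates \<open>F\<close> through its arguments
  \<open>X\<^sub>i u\<close>, the resulting terms \<open>(\<partial>F/\<partial>p\<^sub>i) T (X\<^sub>i u)\<close> are cancelled by the second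
  part of the flux, up to \<open>- (\<partial>F/\<partial>p\<^sub>i) X\<^sub>i u\<close>.

  Every function involved is continuous near the compact closure of \<open>\<Omega>\<close>, so all volume
  integrals exist and may be split. The divergence theorem is applied separately to the two
  parts of the flux, each of class \<open>C\<^sup>1\<close>.
\<close>

section \<open>Calculus of partial derivatives\<close>

lemma Basis_vec_real: "(b::real^'n::finite) \<in> Basis \<longleftrightarrow> (\<exists>i. b = axis i 1)"
  by (auto simp: Basis_vec_def)

lemma Ck_on_1_iff:
  fixes f :: "real^'n::finite \<Rightarrow> real"
  shows "Ck_on 1 U f \<longleftrightarrow> (\<forall>x\<in>U. f differentiable (at x)) \<and> (\<forall>i. continuous_on U (partial i f))"
  unfolding One_nat_def Ck_on.simps partial_def[abs_def] by (auto simp: Ball_def Basis_vec_real)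

lemma Ck_on_Suc_partial:
  fixes f :: "real^'n::finite \<Rightarrow> real"
  shows "Ck_on (Suc k) U f \<longleftrightarrow> (\<forall>x\<in>U. f differentiable (at x)) \<and> (\<forall>i. Ck_on k U (partial i f))"
  unfolding Ck_on.simps partial_def[abs_def] by (auto simp: Ball_def Basis_vec_real)

lemma Ck_on_imp_continuous:
  assumes "Ck_on k U f"
  shows "continuous_on U f"
proof (cases k)
  case 0
  with assms show ?thesis by simp
next
  case (Suc l)
  with assms show ?thesis
    by (auto intro!: continuous_at_imp_continuous_on differentiable_imp_continuous_within)
qed

lemma Ck_on_Suc_imp: "Ck_on (Suc k) U f \<Longrightarrow> Ck_on k U f"
proof (induction k arbitrary: f)
  case 0
  then show ?case using Ck_on_imp_continuous[of "Suc 0"] by simp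
next
  case (Suc k)
  then show ?case by (metis Ck_on.simps(2))
qed

lemma Ck_on_mono: "Ck_on k U f \<Longrightarrow> W \<subseteq> U \<Longrightarrow> Ck_on k W f"
  by (induction k arbitrary: f) (auto intro: continuous_on_subset)

lemma has_derivative_partial:
  assumes "(f has_derivative D) (at x)"
  shows "partial i f x = D (axis i 1)"
  using assms by (simp add: partial_def frechet_derivative_at[symmetric])

lemma frechet_derivative_has_derivative:
  "f differentiable (at x) \<Longrightarrow> (f has_derivative frechet_derivative f (at x)) (at x)"
  by (simp add: frechet_derivative_works[symmetric])

lemma partial_sum:
  assumes "\<And>a. a \<in> A \<Longrightarrow> f a differentiable (at x)"
  shows "partial i (\<lambda>y. \<Sum>a\<in>A. f a y) x = (\<Sum>a\<in>A. partial i (f a) x)"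
proof -
  have "((\<lambda>y. \<Sum>a\<in>A. f a y) has_derivative (\<lambda>v. \<Sum>a\<in>A. frechet_derivative (f a) (at x) v)) (at x)"
    by (intro has_derivative_sum frechet_derivative_has_derivative assms)
  from has_derivative_partial[OF this] show ?thesis by (simp add: partial_def)
qed

lemma partial_mult:
  assumes "f differentiable (at x)" "g differentiable (at x)"
  shows "partial i (\<lambda>y. f y * g y) x = f x * partial i g x + partial i f x * g x"
proof -
  have "((\<lambda>y. f y * g y) has_derivative (\<lambda>v. f x * frechet_derivative g (at x) v
          + frechet_derivative f (at x) v * g x)) (at x)"
    by (intro has_derivative_mult frechet_derivative_has_derivative assms)
  from has_derivative_partial[OF this] show ?thesis by (simp add: partial_def)
qed

lemma has_derivative_const_mult_nth:
  "((\<lambda>y::real^'n::finite. c * y $ j) has_derivative (\<lambda>v. c * v $ j)) (at x)"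
  by (intro bounded_linear_imp_has_derivative
        bounded_linear_const_mult[OF bounded_linear_vec_nth])

lemma partial_const_mult_nth:
  "partial i (\<lambda>y::real^'n::finite. c * y $ j) x = (if i = j then c else 0)"
  using has_derivative_partial[OF has_derivative_const_mult_nth, of i c j x]
  by (auto simp: axis_def)

lemma Ck_on_1_mult:
  fixes f g :: "real^'n::finite \<Rightarrow> real"
  assumes "Ck_on 1 U f" "Ck_on 1 U g"
  shows "Ck_on 1 U (\<lambda>x. f x * g x)"
proof -
  note c = assms[THEN Ck_on_imp_continuous]
  note d = assms[unfolded Ck_on_1_iff]
  have "continuous_on U (partial i (\<lambda>x. f x * g x))" for i
  proof -
    have "continuous_on U (\<lambda>x. f x * partial i g x + partial i f x * g x)"
      using c d by (intro continuous_intros) auto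
    then show ?thesis
      by (rule continuous_on_cong[THEN iffD1, rotated 2]) (use d in \<open>auto simp: partial_mult\<close>)
  qed
  then show ?thesis using d unfolding Ck_on_1_iff by auto
qed

lemma Ck_on_1_sum:
  fixes f :: "'a \<Rightarrow> real^'n::finite \<Rightarrow> real"
  assumes "finite A" "\<And>a. a \<in> A \<Longrightarrow> Ck_on 1 U (f a)"
  shows "Ck_on 1 U (\<lambda>x. \<Sum>a\<in>A. f a x)"
proof -
  have d: "\<And>a x. a \<in> A \<Longrightarrow> x \<in> U \<Longrightarrow> f a differentiable (at x)"
    and c: "\<And>a i. a \<in> A \<Longrightarrow> continuous_on U (partial i (f a))"
    using assms(2) unfolding Ck_on_1_iff by blast+
  have "continuous_on U (partial i (\<lambda>x. \<Sum>a\<in>A. f a x))" for i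
  proof -
    have "continuous_on U (\<lambda>x. \<Sum>a\<in>A. partial i (f a) x)"
      using c by (intro continuous_intros) auto
    then show ?thesis
      by (rule continuous_on_cong[THEN iffD1, rotated 2]) (use d in \<open>auto simp: partial_sum\<close>)
  qed
  then show ?thesis using d assms(1) unfolding Ck_on_1_iff by auto
qed

lemma Ck_on_const_mult_nth:
  "Ck_on k U (\<lambda>y::real^'n::finite. c * y $ j)"
proof -
  have const: "Ck_on l U (\<lambda>y. d)" for l and d :: real
    by (induction l arbitrary: d) auto
  have diff: "(\<lambda>y::real^'n. c * y $ j) differentiable (at x)" for x
    using has_derivative_const_mult_nth[of c j x] by (auto simp: differentiable_def)
  have part: "partial i (\<lambda>y::real^'n. c * y $ j) = (\<lambda>_. if i = j then c else 0)" for i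
    by (auto simp: partial_const_mult_nth)
  show ?thesis
  proof (cases k)
    case 0
    then show ?thesis by (auto intro!: continuous_intros)
  next
    case (Suc l)
    then show ?thesis by (simp only: Ck_on_Suc_partial part const diff) simp
  qed
qed

lemma frechet_derivative_vec_nth:
  fixes V :: "'a::real_normed_vector \<Rightarrow> real^'n::finite"
  assumes "V differentiable (at x)"
  shows "(\<lambda>y. V y $ j) differentiable (at x)"
    and "frechet_derivative (\<lambda>y. V y $ j) (at x) v = frechet_derivative V (at x) v $ j"
proof -
  have "((\<lambda>y. V y $ j) has_derivative (\<lambda>v. frechet_derivative V (at x) v $ j)) (at x)"
    by (rule bounded_linear.has_derivative[OF bounded_linear_vec_nth
          frechet_derivative_has_derivative[OF assms]])
  then show "(\<lambda>y. V y $ j) differentiable (at x)"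
    "frechet_derivative (\<lambda>y. V y $ j) (at x) v = frechet_derivative V (at x) v $ j"
    by (auto simp: differentiable_def frechet_derivative_at[symmetric])
qed

lemma differentiable_vecI:
  fixes V :: "'a::real_normed_vector \<Rightarrow> real^'n::finite"
  assumes "\<And>j. (\<lambda>y. V y $ j) differentiable (at x)"
  shows "V differentiable (at x)"
  using assms
  by (subst differentiable_componentwise_within) (auto simp: Basis_vec_real inner_axis)

lemma Ck_on_1_vec_iff:
  fixes V :: "real^'k::finite \<Rightarrow> real^'n::finite"
  shows "Ck_on 1 U V \<longleftrightarrow> (\<forall>j. Ck_on 1 U (\<lambda>x. V x $ j))"
proof -
  have *: "continuous_on U (\<lambda>x. frechet_derivative V (at x) b) \<longleftrightarrow>
         (\<forall>j. continuous_on U (\<lambda>x. frechet_derivative (\<lambda>x. V x $ j) (at x) b))"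
    if d: "\<forall>x\<in>U. V differentiable (at x)" for b
  proof -
    have "continuous_on U (\<lambda>x. frechet_derivative V (at x) b) \<longleftrightarrow>
          (\<forall>j. continuous_on U (\<lambda>x. frechet_derivative V (at x) b $ j))"
      by (subst continuous_on_componentwise) (auto simp: Ball_def Basis_vec_real inner_axis)
    also have "\<dots> \<longleftrightarrow> (\<forall>j. continuous_on U (\<lambda>x. frechet_derivative (\<lambda>x. V x $ j) (at x) b))"
      by (intro all_cong1 continuous_on_cong) (simp_all add: d frechet_derivative_vec_nth(2))
    finally show ?thesis .
  qed
  have **: "(\<forall>x\<in>U. V differentiable (at x)) \<longleftrightarrow> (\<forall>j. \<forall>x\<in>U. (\<lambda>x. V x $ j) differentiable (at x))"
    by (blast intro: differentiable_vecI frechet_derivative_vec_nth(1))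
  show ?thesis
    unfolding One_nat_def Ck_on.simps using * ** by blast
qed

lemma continuous_on_divergence:
  assumes "Ck_on 1 U V"
  shows "continuous_on U (divergence V)"
  using assms unfolding Ck_on_1_vec_iff Ck_on_1_iff divergence_def[abs_def]
  by (intro continuous_intros) auto

section \<open>Symmetry of second partial derivatives\<close>

lemma has_real_derivative_along_axis:
  fixes f :: "real^'n::finite \<Rightarrow> real"
  assumes "f differentiable (at (p + s *\<^sub>R axis i 1))"
  shows "((\<lambda>s. f (p + s *\<^sub>R axis i 1)) has_real_derivative partial i f (p + s *\<^sub>R axis i 1)) (at s)"
proof -
  have 1: "((\<lambda>s. p + s *\<^sub>R axis i 1) has_derivative (\<lambda>h. h *\<^sub>R axis i 1)) (at s)"
    by (auto intro!: derivative_eq_intros)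
  from has_derivative_compose[OF 1 frechet_derivative_has_derivative[OF assms]]
  have "((\<lambda>s. f (p + s *\<^sub>R axis i 1)) has_derivative
       (\<lambda>h. frechet_derivative f (at (p + s *\<^sub>R axis i 1)) (h *\<^sub>R axis i 1))) (at s)" .
  moreover have "frechet_derivative f (at (p + s *\<^sub>R axis i 1)) (h *\<^sub>R axis i 1)
         = partial i f (p + s *\<^sub>R axis i 1) * h" for h
    using linear_frechet_derivative[OF assms] by (simp add: linear_cmul partial_def)
  ultimately show ?thesis by (simp add: has_field_derivative_def)
qed

text \<open>Two applications of the mean value theorem. The left-hand side is symmetric in
  \<open>i\<close> and \<open>j\<close>, which is what forces the mixed partial derivatives to agree in the limit.\<close>

lemma second_difference:
  fixes f :: "real^'n::finite \<Rightarrow> real"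
  assumes h: "h > 0"
    and f: "\<And>y. y \<in> cball x (2*h) \<Longrightarrow> f differentiable (at y)"
    and fi: "\<And>y. y \<in> cball x (2*h) \<Longrightarrow> partial i f differentiable (at y)"
  shows "\<exists>y\<in>cball x (2*h). f (x + h *\<^sub>R axis i 1 + h *\<^sub>R axis j 1) - f (x + h *\<^sub>R axis i 1)
            - f (x + h *\<^sub>R axis j 1) + f x = h\<^sup>2 * partial j (partial i f) y"
proof -
  have in_ball: "x + s *\<^sub>R axis i 1 + t *\<^sub>R axis j 1 \<in> cball x (2*h)"
    if "0 \<le> s" "s \<le> h" "0 \<le> t" "t \<le> h" for s t
  proof -
    have "norm (s *\<^sub>R axis i 1 + t *\<^sub>R axis j (1::real) :: real^'n) \<le> s + t"
      using norm_triangle_ineq[of "s *\<^sub>R axis i 1 :: real^'n" "t *\<^sub>R axis j (1::real)"] that by simp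
    moreover have "dist x (x + s *\<^sub>R axis i 1 + t *\<^sub>R axis j 1)
        = norm (s *\<^sub>R axis i 1 + t *\<^sub>R axis j (1::real) :: real^'n)"
      by (metis add.assoc add_diff_cancel_left' dist_commute dist_norm)
    ultimately show ?thesis using that by simp
  qed
  define \<phi> where "\<phi> s = f (x + h *\<^sub>R axis j 1 + s *\<^sub>R axis i 1) - f (x + s *\<^sub>R axis i 1)" for s
  have "(\<phi> has_real_derivative partial i f (x + h *\<^sub>R axis j 1 + s *\<^sub>R axis i 1)
             - partial i f (x + s *\<^sub>R axis i 1)) (at s)" if "0 \<le> s" "s \<le> h" for s
    unfolding \<phi>_def using that in_ball[of s h] in_ball[of s 0] h
    by (intro DERIV_diff has_real_derivative_along_axis f) (simp_all add: algebra_simps)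
  from MVT2[OF h this] obtain s where s: "0 < s" "s < h" and
    s': "\<phi> h - \<phi> 0 = h * (partial i f (x + h *\<^sub>R axis j 1 + s *\<^sub>R axis i 1)
             - partial i f (x + s *\<^sub>R axis i 1))" by auto
  have "((\<lambda>t. partial i f (x + s *\<^sub>R axis i 1 + t *\<^sub>R axis j 1)) has_real_derivative
           partial j (partial i f) (x + s *\<^sub>R axis i 1 + t *\<^sub>R axis j 1)) (at t)"
    if "0 \<le> t" "t \<le> h" for t
    using that in_ball[of s t] s by (intro has_real_derivative_along_axis fi) auto
  from MVT2[OF h this] obtain t where t: "0 < t" "t < h" and
    t': "partial i f (x + s *\<^sub>R axis i 1 + h *\<^sub>R axis j 1) - partial i f (x + s *\<^sub>R axis i 1)
       = h * partial j (partial i f) (x + s *\<^sub>R axis i 1 + t *\<^sub>R axis j 1)" by auto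
  have "\<phi> h - \<phi> 0 = h * (h * partial j (partial i f) (x + s *\<^sub>R axis i 1 + t *\<^sub>R axis j 1))"
    unfolding s' t'[symmetric] by (simp add: algebra_simps)
  then show ?thesis using in_ball[of s t] s t
    by (intro bexI[of _ "x + s *\<^sub>R axis i 1 + t *\<^sub>R axis j 1"])
       (auto simp: \<phi>_def power2_eq_square algebra_simps)
qed

lemma partial_commute:
  fixes f :: "real^'n::finite \<Rightarrow> real"
  assumes U: "open U" and f: "Ck_on 2 U f" and x: "x \<in> U"
  shows "partial i (partial j f) x = partial j (partial i f) x"
proof (rule ccontr)
  assume ne: "\<not> ?thesis"
  have 2: "Ck_on (Suc 1) U f" using f by (simp add: numeral_2_eq_2)
  have df: "f differentiable (at y)" if "y \<in> U" for y
    using 2 that unfolding Ck_on_Suc_partial by blast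
  have C1: "Ck_on 1 U (partial k f)" for k
    using 2 unfolding Ck_on_Suc_partial by blast
  have dp: "partial k f differentiable (at y)" if "y \<in> U" for y k
    using C1[of k] that unfolding Ck_on_1_iff by blast
  have cp: "continuous (at x) (partial l (partial k f))" for k l
    using C1[of k] U x unfolding Ck_on_1_iff by (simp add: continuous_on_eq_continuous_at)
  define e where "e = dist (partial i (partial j f) x) (partial j (partial i f) x) / 2"
  have e: "e > 0" using ne by (simp add: e_def)
  obtain d1 where d1: "d1 > 0"
    "\<And>y. dist y x < d1 \<Longrightarrow> dist (partial i (partial j f) y) (partial i (partial j f) x) < e"
    using cp[of i j] e unfolding continuous_at_eps_delta dist_norm by metis
  obtain d2 where d2: "d2 > 0"
    "\<And>y. dist y x < d2 \<Longrightarrow> dist (partial j (partial i f) y) (partial j (partial i f) x) < e"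
    using cp[of j i] e unfolding continuous_at_eps_delta dist_norm by metis
  obtain r where r: "r > 0" "ball x r \<subseteq> U" using U x by (auto simp: open_contains_ball)
  \<comment> \<open>The evaluation points lie in the closed ball of radius \<open>2 h\<close>, which the factor
    \<open>3\<close> keeps strictly inside all three neighbourhoods.\<close>
  define h where "h = min r (min d1 d2) / 3"
  have h: "h > 0" using d1 d2 r by (simp add: h_def)
  have small: "dist y x < min r (min d1 d2)" if "y \<in> cball x (2*h)" for y
    using that h by (auto simp: h_def dist_commute)
  have inU: "y \<in> U" if "y \<in> cball x (2*h)" for y
    using small[OF that] r by (auto simp: dist_commute)
  from second_difference[OF h df[OF inU] dp[OF inU], of x i j] obtain y where
    y: "y \<in> cball x (2*h)" "f (x + h *\<^sub>R axis i 1 + h *\<^sub>R axis j 1) - f (x + h *\<^sub>R axis i 1)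
            - f (x + h *\<^sub>R axis j 1) + f x = h\<^sup>2 * partial j (partial i f) y" by auto
  from second_difference[OF h df[OF inU] dp[OF inU], of x j i] obtain z where
    z: "z \<in> cball x (2*h)" "f (x + h *\<^sub>R axis j 1 + h *\<^sub>R axis i 1) - f (x + h *\<^sub>R axis j 1)
            - f (x + h *\<^sub>R axis i 1) + f x = h\<^sup>2 * partial i (partial j f) z" by auto
  have "h\<^sup>2 * partial j (partial i f) y = h\<^sup>2 * partial i (partial j f) z"
    unfolding y(2)[symmetric] z(2)[symmetric] by (simp add: algebra_simps)
  then have "partial j (partial i f) y = partial i (partial j f) z" using h by simp
  moreover have "dist (partial i (partial j f) z) (partial i (partial j f) x) < e"
    "dist (partial j (partial i f) y) (partial j (partial i f) x) < e"
    using d1(2)[of z] d2(2)[of y] small[OF y(1)] small[OF z(1)] by auto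
  ultimately show False
    unfolding e_def dist_real_def by (auto simp: abs_if split: if_splits)
qed

section \<open>Fields homogeneous of degree one\<close>

text \<open>Homogeneity tested on the coordinate functions: the \<open>j\<close>-th coefficient of \<open>Y\<close> is
  homogeneous of degree \<open>\<sigma> j - 1\<close> (written without natural-number subtraction).\<close>

lemma homogeneous_coefficient_scaling:
  assumes "homogeneous_degree_one \<sigma> Y" "l > 0"
  shows "l ^ \<sigma> j * Y x $ j = l * Y (dilation \<sigma> l x) $ j"
proof -
  have sm: "smooth (\<lambda>y::real^'a. y $ j)"
    using Ck_on_const_mult_nth[of _ UNIV 1 j] by (simp add: smooth_def)
  have 1: "vf_apply Z (\<lambda>y. c * y $ j) x = c * Z x $ j" for Z :: "real^'a \<Rightarrow> real^'a" and c x
    by (simp add: vf_apply_def partial_const_mult_nth if_distrib cong: if_cong)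
  have "vf_apply Y ((\<lambda>y. y $ j) \<circ> dilation \<sigma> l) x = l * vf_apply Y (\<lambda>y. y $ j) (dilation \<sigma> l x)"
    using assms sm unfolding homogeneous_degree_one_def by blast
  then show ?thesis
    using 1[of Y "l ^ \<sigma> j" x] 1[of Y 1 "dilation \<sigma> l x"] by (simp add: o_def dilation_def)
qed

lemma has_derivative_dilation:
  "((\<lambda>y. dilation \<sigma> l y) has_derivative dilation \<sigma> l) (at x)"
proof -
  have "bounded_linear (dilation \<sigma> l)"
    by (intro linear_conv_bounded_linear[THEN iffD1] linearI)
       (auto simp: dilation_def vec_eq_iff algebra_simps)
  then show ?thesis by (rule bounded_linear_imp_has_derivative)
qed

text \<open>The derivative in direction \<open>j\<close> of the \<open>j\<close>-th coefficient has degree \<open>-1\<close>. A continuous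
  function of negative degree vanishes: let the dilation parameter tend to \<open>0\<close>. In particular a
  homogeneous field of degree one is divergence free.\<close>

lemma homogeneous_diagonal_partial_eq_0:
  fixes Y :: "real^'n::finite \<Rightarrow> real^'n"
  assumes hom: "homogeneous_degree_one \<sigma> Y" and sm: "Ck_on 1 UNIV Y" and pos: "\<And>k. \<sigma> k \<ge> 1"
  shows "partial j (\<lambda>y. Y y $ j) x = 0"
proof -
  define a where "a = (\<lambda>y. Y y $ j)"
  have a: "a differentiable (at y)" "continuous_on UNIV (partial j a)" for y
    using sm unfolding a_def Ck_on_1_vec_iff Ck_on_1_iff by auto
  have scale: "partial j a x = l * partial j a (dilation \<sigma> l x)" if l: "l > 0" for l
  proof -
    have "((\<lambda>y. l * a (dilation \<sigma> l y)) has_derivative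
            (\<lambda>v. l * frechet_derivative a (at (dilation \<sigma> l x)) (dilation \<sigma> l v))) (at x)"
      by (intro has_derivative_mult_right
            has_derivative_compose[OF has_derivative_dilation frechet_derivative_has_derivative] a)
    moreover have "dilation \<sigma> l (axis j 1) = l ^ \<sigma> j *\<^sub>R axis j 1"
      by (auto simp: dilation_def vec_eq_iff axis_def)
    ultimately have "partial j (\<lambda>y. l * a (dilation \<sigma> l y)) x
        = l * (l ^ \<sigma> j * partial j a (dilation \<sigma> l x))"
      using has_derivative_partial linear_frechet_derivative[OF a(1)]
      by (fastforce simp: linear_cmul partial_def)
    moreover have "(\<lambda>y. l * a (dilation \<sigma> l y)) = (\<lambda>y. l ^ \<sigma> j * a y)"
      using homogeneous_coefficient_scaling[OF hom l] by (simp add: a_def)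
    moreover have "partial j (\<lambda>y. l ^ \<sigma> j * a y) x = l ^ \<sigma> j * partial j a x"
      using has_derivative_partial[OF has_derivative_mult_right[OF
            frechet_derivative_has_derivative[OF a(1)]]] by (simp add: partial_def)
    ultimately show ?thesis using l by simp
  qed
  have "((\<lambda>l. l * partial j a (dilation \<sigma> l x)) \<longlongrightarrow> 0 * partial j a (dilation \<sigma> 0 x)) (at_right 0)"
  proof (intro tendsto_mult tendsto_ident_at)
    have "continuous_on UNIV (\<lambda>l. partial j a (dilation \<sigma> l x))"
      unfolding dilation_def
      by (rule continuous_on_compose2[OF a(2)]) (auto intro!: continuous_intros)
    then show "((\<lambda>l. partial j a (dilation \<sigma> l x)) \<longlongrightarrow> partial j a (dilation \<sigma> 0 x)) (at_right 0)"
      using tendsto_within_subset[of _ _ 0 UNIV "{0<..}"] by (auto simp: continuous_on_def)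
  qed
  moreover have "eventually (\<lambda>l. l * partial j a (dilation \<sigma> l x) = partial j a x) (at_right 0)"
    using scale by (intro eventually_at_rightI[of 0 1]) auto
  ultimately have "((\<lambda>l::real. partial j a x) \<longlongrightarrow> 0) (at_right 0)"
    using tendsto_cong by fastforce
  then show ?thesis
    using tendsto_unique[OF _ tendsto_const] by (force simp: a_def)
qed

text \<open>Euler's identity: the scaling relation of the coefficients, differentiated in the dilation
  parameter at \<open>1\<close>.\<close>

lemma homogeneous_Euler:
  fixes Y :: "real^'n::finite \<Rightarrow> real^'n"
  assumes hom: "homogeneous_degree_one \<sigma> Y" and sm: "Ck_on 1 UNIV Y"
  shows "vf_apply (dil_generator \<sigma>) (\<lambda>y. Y y $ j) x = (real (\<sigma> j) - 1) * Y x $ j"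
proof -
  define a where "a = (\<lambda>y. Y y $ j)"
  have a: "a differentiable (at y)" for y
    using sm unfolding a_def Ck_on_1_vec_iff Ck_on_1_iff by auto
  have curve: "((\<lambda>l. dilation \<sigma> l x) has_derivative (\<lambda>h. h *\<^sub>R dil_generator \<sigma> x)) (at 1)"
  proof (subst has_derivative_componentwise_within, intro ballI)
    fix b :: "real^'n" assume "b \<in> Basis"
    then obtain k where b: "b = axis k 1" by (auto simp: Basis_vec_real)
    show "((\<lambda>l. dilation \<sigma> l x \<bullet> b) has_derivative (\<lambda>h. h *\<^sub>R dil_generator \<sigma> x \<bullet> b)) (at 1)"
      unfolding b inner_axis dilation_def dil_generator_def
      by (auto intro!: derivative_eq_intros)
  qed
  have one: "dilation \<sigma> 1 x = x" by (simp add: dilation_def)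
  have "((\<lambda>l. l * a (dilation \<sigma> l x)) has_derivative
        (\<lambda>h. 1 * frechet_derivative a (at x) (h *\<^sub>R dil_generator \<sigma> x) + h * a x)) (at 1)"
    using has_derivative_mult[OF has_derivative_ident has_derivative_compose[OF curve
        frechet_derivative_has_derivative[OF a]]] by (simp only: one)
  moreover have "((\<lambda>l. l * a (dilation \<sigma> l x)) has_derivative (\<lambda>h. real (\<sigma> j) * h * a x)) (at 1)"
  proof (rule has_derivative_transform_within_open)
    show "((\<lambda>l. l ^ \<sigma> j * a x) has_derivative (\<lambda>h. real (\<sigma> j) * h * a x)) (at 1)"
      by (auto intro!: derivative_eq_intros)
    show "open {0::real<..}" "1 \<in> {0::real<..}" by auto
    show "l ^ \<sigma> j * a x = l * a (dilation \<sigma> l x)" if "l \<in> {0<..}" for l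
      using homogeneous_coefficient_scaling[OF hom] that by (simp add: a_def)
  qed
  ultimately have "(\<lambda>h. 1 * frechet_derivative a (at x) (h *\<^sub>R dil_generator \<sigma> x) + h * a x)
      = (\<lambda>h. real (\<sigma> j) * h * a x)"
    by (rule has_derivative_unique)
  from fun_cong[OF this, of 1]
  have "frechet_derivative a (at x) (dil_generator \<sigma> x) = (real (\<sigma> j) - 1) * a x"
    by (simp add: algebra_simps)
  moreover have "frechet_derivative a (at x) (dil_generator \<sigma> x) = vf_apply (dil_generator \<sigma>) a x"
  proof -
    interpret linear "frechet_derivative a (at x)" by (rule linear_frechet_derivative[OF a])
    have "frechet_derivative a (at x) (dil_generator \<sigma> x)
        = frechet_derivative a (at x) (\<Sum>k\<in>UNIV. (dil_generator \<sigma> x $ k) *\<^sub>R axis k 1)"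
      using basis_expansion[of "dil_generator \<sigma> x"] by (simp add: scalar_mult_eq_scaleR)
    also have "\<dots> = (\<Sum>k\<in>UNIV. (dil_generator \<sigma> x $ k) * frechet_derivative a (at x) (axis k 1))"
      by (simp only: sum scale real_scaleR_def)
    finally show ?thesis by (simp add: vf_apply_def partial_def)
  qed
  ultimately show ?thesis by (simp add: a_def)
qed

section \<open>Lagrangians along the jet of a function\<close>

lemma partial_jet:
  fixes F :: "('n::finite, 'm::finite) lagrangian"
  assumes F: "F differentiable (at (X_jet X u x))" and u: "u differentiable (at x)"
    and Xu: "\<And>i. (\<lambda>y. vf_apply (X i) u y) differentiable (at x)"
  shows "(\<lambda>y. F (X_jet X u y)) differentiable (at x)"
    and "partial k (\<lambda>y. F (X_jet X u y)) x = d_x k F (X_jet X u x) + d_z F (X_jet X u x) * partial k u x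
      + (\<Sum>i\<in>UNIV. d_p i F (X_jet X u x) * partial k (\<lambda>y. vf_apply (X i) u y) x)"
proof -
  have g: "(\<lambda>y. X_grad X u y) differentiable (at x)"
    using Xu by (intro differentiable_vecI) (simp add: X_grad_def)
  define G where "G = frechet_derivative (\<lambda>y. X_grad X u y) (at x) (axis k 1)"
  have Gi: "G $ i = partial k (\<lambda>y. vf_apply (X i) u y) x" for i
    unfolding G_def partial_def frechet_derivative_vec_nth(2)[OF g, symmetric]
    by (simp add: X_grad_def)
  define L where "L = frechet_derivative F (at (X_jet X u x))"
  interpret L: linear L unfolding L_def by (rule linear_frechet_derivative[OF F])
  have "((\<lambda>y. X_jet X u y) has_derivative
      (\<lambda>v. (v, frechet_derivative u (at x) v, frechet_derivative (\<lambda>y. X_grad X u y) (at x) v))) (at x)"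
    unfolding X_jet_def
    by (intro has_derivative_Pair has_derivative_ident frechet_derivative_has_derivative u g)
  from has_derivative_compose[OF this frechet_derivative_has_derivative[OF F]]
  have D: "((\<lambda>y. F (X_jet X u y)) has_derivative
      (\<lambda>v. L (v, frechet_derivative u (at x) v, frechet_derivative (\<lambda>y. X_grad X u y) (at x) v))) (at x)"
    by (simp add: L_def)
  then show "(\<lambda>y. F (X_jet X u y)) differentiable (at x)" by (auto simp: differentiable_def)
  have "G = (\<Sum>i\<in>UNIV. G $ i *\<^sub>R axis i 1)"
    using basis_expansion[of G] by (simp add: scalar_mult_eq_scaleR)
  then have "(axis k 1 :: real^'n, partial k u x, G) = (axis k 1, 0, 0) + partial k u x *\<^sub>R (0, 1, 0)
      + (\<Sum>i\<in>UNIV. G $ i *\<^sub>R (0, 0, axis i 1))"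
    by (simp add: prod_eq_iff fst_sum snd_sum)
  then have "L (axis k 1, partial k u x, G) = L (axis k 1, 0, 0) + partial k u x * L (0, 1, 0)
      + (\<Sum>i\<in>UNIV. G $ i * L (0, 0, axis i 1))"
    by (simp only: L.add L.sum L.scale real_scaleR_def)
  with has_derivative_partial[OF D, of k] show
   "partial k (\<lambda>y. F (X_jet X u y)) x = d_x k F (X_jet X u x) + d_z F (X_jet X u x) * partial k u x
      + (\<Sum>i\<in>UNIV. d_p i F (X_jet X u x) * partial k (\<lambda>y. vf_apply (X i) u y) x)"
    by (simp add: Gi[symmetric] d_x_def d_z_def d_p_def L_def[symmetric] mult.commute
        partial_def[of k u x] G_def[symmetric])
qed

lemma Ck_on_1_lagrangian:
  fixes F :: "('n::finite, 'm::finite) lagrangian"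
  assumes "Ck_on 1 W F"
  shows "\<And>w. w \<in> W \<Longrightarrow> F differentiable (at w)"
    and "continuous_on W (d_x k F)" "continuous_on W (d_z F)" "continuous_on W (d_p i F)"
proof -
  have d: "\<forall>w\<in>W. F differentiable (at w)"
    and c: "\<And>b. b \<in> Basis \<Longrightarrow> continuous_on W (\<lambda>w. frechet_derivative F (at w) b)"
    using assms unfolding One_nat_def Ck_on.simps by auto
  show "\<And>w. w \<in> W \<Longrightarrow> F differentiable (at w)" using d by blast
  show "continuous_on W (d_x k F)" "continuous_on W (d_z F)" "continuous_on W (d_p i F)"
    unfolding d_x_def[abs_def] d_z_def[abs_def] d_p_def[abs_def]
    by (rule c; auto simp: Basis_prod_def image_iff Bex_def Basis_vec_real zero_prod_def)+
qed

lemma Ck_on_1_jet: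
  fixes F :: "('n::finite, 'm::finite) lagrangian"
  assumes F: "Ck_on 1 W F" and u: "Ck_on 1 U u"
    and Xu: "\<And>i. Ck_on 1 U (\<lambda>y. vf_apply (X i) u y)"
    and sub: "X_jet X u ` U \<subseteq> W" and cj: "continuous_on U (X_jet X u)"
  shows "Ck_on 1 U (\<lambda>y. F (X_jet X u y))"
proof -
  have du: "u differentiable (at x)" "(\<lambda>y. vf_apply (X i) u y) differentiable (at x)"
    "F differentiable (at (X_jet X u x))" if "x \<in> U" for x i
    using that u Xu[of i] sub Ck_on_1_lagrangian(1)[OF F, of "X_jet X u x"] unfolding Ck_on_1_iff
    by auto
  have cu: "continuous_on U (partial k u)" "continuous_on U (partial k (\<lambda>y. vf_apply (X i) u y))" for i k
    using u Xu[of i] unfolding Ck_on_1_iff by auto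
  note comp = continuous_on_compose2[OF _ cj sub]
  have "continuous_on U (partial k (\<lambda>y. F (X_jet X u y)))" for k
  proof -
    have "continuous_on U (\<lambda>x. d_x k F (X_jet X u x) + d_z F (X_jet X u x) * partial k u x
      + (\<Sum>i\<in>UNIV. d_p i F (X_jet X u x) * partial k (\<lambda>y. vf_apply (X i) u y) x))"
      by (intro continuous_intros cu comp Ck_on_1_lagrangian[OF F])
    then show ?thesis
      by (rule continuous_on_cong[THEN iffD1, rotated 2]) (use du in \<open>auto simp: partial_jet\<close>)
  qed
  then show ?thesis unfolding Ck_on_1_iff using du by (auto intro!: partial_jet(1))
qed

section \<open>Divergences and iterated derivatives along vector fields\<close>

lemma divergence_scaleR:
  assumes "f differentiable (at x)" "\<And>j. (\<lambda>y. V y $ j) differentiable (at x)"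
  shows "divergence (\<lambda>y. f y *\<^sub>R V y) x = vf_apply V f x + f x * divergence V x"
  using assms
  by (simp add: divergence_def vf_apply_def partial_mult sum.distrib sum_distrib_left algebra_simps)

lemma divergence_sum:
  assumes "\<And>a j. a \<in> A \<Longrightarrow> (\<lambda>y. V a y $ j) differentiable (at x)"
  shows "divergence (\<lambda>y. \<Sum>a\<in>A. V a y) x = (\<Sum>a\<in>A. divergence (V a) x)"
  using assms by (simp add: divergence_def partial_sum sum.swap[of _ A])

lemma divergence_dil_generator: "divergence (dil_generator \<sigma>) x = real (\<Sum>k\<in>UNIV. \<sigma> k)"
  by (simp add: divergence_def dil_generator_def partial_const_mult_nth)

lemma vf_apply_sum_scaleR:
  "vf_apply (\<lambda>y. \<Sum>a\<in>A. p a y *\<^sub>R Y a y) f x = (\<Sum>a\<in>A. p a x * vf_apply (Y a) f x)"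
  by (simp add: vf_apply_def sum_distrib_left sum_distrib_right mult.assoc sum.swap[of _ A])

lemma Ck_on_1_vf_apply:
  assumes u: "Ck_on 2 U u" and Y: "Ck_on 1 U Y"
  shows "Ck_on 1 U (vf_apply Y u)"
proof -
  have "Ck_on (Suc 1) U u" using u by (simp add: numeral_2_eq_2)
  then have "Ck_on 1 U (partial j u)" for j unfolding Ck_on_Suc_partial by blast
  then show ?thesis
    using Y unfolding vf_apply_def[abs_def] Ck_on_1_vec_iff
    by (intro Ck_on_1_sum Ck_on_1_mult) auto
qed

lemma vf_apply_vf_apply:
  assumes u: "Ck_on 2 U u" and Z: "Ck_on 1 U Z" and x: "x \<in> U"
  shows "vf_apply Y (vf_apply Z u) x
    = (\<Sum>j\<in>UNIV. \<Sum>k\<in>UNIV. Y x $ k * Z x $ j * partial k (partial j u) x)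
      + (\<Sum>j\<in>UNIV. vf_apply Y (\<lambda>y. Z y $ j) x * partial j u x)"
proof -
  have "Ck_on (Suc 1) U u" using u by (simp add: numeral_2_eq_2)
  then have "Ck_on 1 U (partial j u)" for j unfolding Ck_on_Suc_partial by blast
  then have d: "partial j u differentiable (at x)" "(\<lambda>y. Z y $ j) differentiable (at x)" for j
    using Z x unfolding Ck_on_1_vec_iff Ck_on_1_iff by blast+
  have Zu: "vf_apply Z u = (\<lambda>y. \<Sum>j\<in>UNIV. Z y $ j * partial j u y)"
    by (rule ext) (rule vf_apply_def)
  have "vf_apply Y (vf_apply Z u) x = (\<Sum>k\<in>UNIV. \<Sum>j\<in>UNIV.
      Y x $ k * (Z x $ j * partial k (partial j u) x + partial k (\<lambda>y. Z y $ j) x * partial j u x))"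
    unfolding Zu vf_apply_def[of Y]
    by (simp add: partial_sum partial_mult d sum_distrib_left)
  also have "\<dots> = (\<Sum>j\<in>UNIV. \<Sum>k\<in>UNIV.
      Y x $ k * (Z x $ j * partial k (partial j u) x + partial k (\<lambda>y. Z y $ j) x * partial j u x))"
    by (rule sum.swap)
  finally show ?thesis
    by (simp add: vf_apply_def algebra_simps sum.distrib sum_distrib_left)
qed

text \<open>The commutation relation \<open>[Y, T] = Y\<close>. The second-order terms of \<open>Y T u\<close> and \<open>T Y u\<close> agree
  by symmetry of the second derivatives; Euler's identity makes the first-order terms differ
  by exactly \<open>Y u\<close>.\<close>

lemma dil_generator_commutator:
  assumes U: "open U" and u: "Ck_on 2 U u" and x: "x \<in> U"
    and hom: "homogeneous_degree_one \<sigma> Y" and Y: "Ck_on 1 UNIV Y"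
  shows "vf_apply Y (vf_apply (dil_generator \<sigma>) u) x
    = vf_apply (dil_generator \<sigma>) (vf_apply Y u) x + vf_apply Y u x"
proof -
  let ?T = "dil_generator \<sigma>"
  have T: "Ck_on 1 U ?T"
    unfolding Ck_on_1_vec_iff dil_generator_def by (simp del: One_nat_def add: Ck_on_const_mult_nth)
  have YT: "vf_apply Y (\<lambda>y. ?T y $ j) x = real (\<sigma> j) * Y x $ j" for j
    by (simp add: vf_apply_def dil_generator_def partial_const_mult_nth if_distrib cong: if_cong)
  \<comment> \<open>Exchanging the summation indices in the second-order part turns \<open>Y T\<close> into \<open>T Y\<close>.\<close>
  have "(\<Sum>j\<in>UNIV. \<Sum>k\<in>UNIV. Y x $ k * ?T x $ j * partial k (partial j u) x)
      = (\<Sum>k\<in>UNIV. \<Sum>j\<in>UNIV. Y x $ k * ?T x $ j * partial k (partial j u) x)"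
    by (rule sum.swap)
  also have "\<dots> = (\<Sum>k\<in>UNIV. \<Sum>j\<in>UNIV. ?T x $ j * Y x $ k * partial j (partial k u) x)"
    by (intro sum.cong) (auto simp: partial_commute[OF U u x] mult_ac)
  finally show ?thesis
    unfolding vf_apply_vf_apply[OF u T x] YT
      vf_apply_vf_apply[OF u Ck_on_mono[OF Y subset_UNIV] x] homogeneous_Euler[OF hom Y]
    by (simp add: vf_apply_def algebra_simps sum_subtractf sum.distrib)
qed

section \<open>The integral identity\<close>

lemma set_integrable_continuous_closure:
  fixes f :: "'a::euclidean_space \<Rightarrow> real"
  assumes "open S" "bounded S" "closure S \<subseteq> U" "continuous_on U f"
  shows "set_integrable lborel S f"
proof (rule set_integrable_subset)
  show "set_integrable lborel (closure S) f"
    unfolding set_integrable_def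
    using borel_integrable_compact[of "closure S" f] assms continuous_on_subset
    by (auto simp: indicator_def if_distrib cong: if_cong)
qed (use assms closure_subset in auto)

text \<open>The pointwise identity behind the theorem: the divergence of the flux
  \<open>F T - (T u) \<Sum>\<^sub>i (\<partial>F/\<partial>p\<^sub>i) X\<^sub>i\<close>, with the two summands kept apart.
  The derivatives \<open>T (X\<^sub>i u)\<close>, produced by the chain rule in the first summand, cancel
  against the \<open>X\<^sub>i (T u)\<close> of the second, up to the commutator \<open>X\<^sub>i u\<close>.\<close>

lemma dilation_flux_divergence:
  fixes X :: "'m::finite \<Rightarrow> real^'n::finite \<Rightarrow> real^'n"
    and F :: "('n, 'm) lagrangian"
  assumes U: "open U" and u: "Ck_on 2 U u" and x: "x \<in> U"
    and X: "\<And>i. Ck_on 1 UNIV (X i)" and hom: "\<And>i. homogeneous_degree_one \<sigma> (X i)"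
    and pos: "\<And>k. \<sigma> k \<ge> 1"
    and F: "F differentiable (at (X_jet X u x))"
    and P: "\<And>i. (\<lambda>y. d_p i F (X_jet X u y)) differentiable (at x)"
  shows "divergence (\<lambda>y. F (X_jet X u y) *\<^sub>R dil_generator \<sigma> y) x
      - divergence (\<lambda>y. vf_apply (dil_generator \<sigma>) u y *\<^sub>R
                        (\<Sum>i\<in>UNIV. d_p i F (X_jet X u y) *\<^sub>R X i y)) x
    = (real (\<Sum>k\<in>UNIV. \<sigma> k) * F (X_jet X u x) - grad_p F (X_jet X u x) \<bullet> X_grad X u x)
      + (\<Sum>i\<in>UNIV. real (\<sigma> i) * x $ i * d_x i F (X_jet X u x))
      + vf_apply (dil_generator \<sigma>) u x *
          (X_div X (\<lambda>y. grad_p F (X_jet X u y)) x + d_z F (X_jet X u x))"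
proof -
  let ?T = "dil_generator \<sigma>" and ?p = "\<lambda>i y. d_p i F (X_jet X u y)"
  have T: "Ck_on 1 UNIV ?T"
    unfolding Ck_on_1_vec_iff dil_generator_def by (simp del: One_nat_def add: Ck_on_const_mult_nth)
  have XU: "Ck_on 1 U (X i)" "Ck_on 1 U ?T" for i
    using X T by (auto intro: Ck_on_mono simp del: One_nat_def)
  have dX: "(\<lambda>y. X i y $ j) differentiable (at x)" "(\<lambda>y. ?T y $ j) differentiable (at x)" for i j
    using X T unfolding Ck_on_1_vec_iff Ck_on_1_iff by blast+
  have dXu: "vf_apply (X i) u differentiable (at x)" "vf_apply ?T u differentiable (at x)" for i
    using Ck_on_1_vf_apply[OF u] XU x unfolding Ck_on_1_iff by blast+
  have du: "u differentiable (at x)"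
    using u x by (simp add: numeral_2_eq_2)
  note jet = partial_jet[where X = X, OF F du dXu(1)]
  have divX: "divergence (X i) x = 0" for i
    by (simp add: divergence_def homogeneous_diagonal_partial_eq_0[OF hom X pos])
  have 1: "divergence (\<lambda>y. F (X_jet X u y) *\<^sub>R ?T y) x
      = vf_apply ?T (\<lambda>y. F (X_jet X u y)) x + F (X_jet X u x) * real (\<Sum>k\<in>UNIV. \<sigma> k)"
    by (simp only: divergence_scaleR[OF jet(1) dX(2)] divergence_dil_generator)
  have 2: "vf_apply ?T (\<lambda>y. F (X_jet X u y)) x
      = (\<Sum>k\<in>UNIV. real (\<sigma> k) * x $ k * d_x k F (X_jet X u x))
        + d_z F (X_jet X u x) * vf_apply ?T u x
        + (\<Sum>i\<in>UNIV. ?p i x * vf_apply ?T (vf_apply (X i) u) x)"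
  proof -
    have "vf_apply ?T (\<lambda>y. F (X_jet X u y)) x
      = (\<Sum>k\<in>UNIV. ?T x $ k * d_x k F (X_jet X u x))
        + (\<Sum>k\<in>UNIV. d_z F (X_jet X u x) * (?T x $ k * partial k u x))
        + (\<Sum>k\<in>UNIV. \<Sum>i\<in>UNIV. ?p i x * (?T x $ k * partial k (vf_apply (X i) u) x))"
      unfolding vf_apply_def[of ?T "\<lambda>y. F (X_jet X u y)"] jet(2)
      by (simp add: algebra_simps sum.distrib sum_distrib_left)
    also have "(\<Sum>k\<in>UNIV. \<Sum>i\<in>UNIV. ?p i x * (?T x $ k * partial k (vf_apply (X i) u) x))
      = (\<Sum>i\<in>UNIV. ?p i x * vf_apply ?T (vf_apply (X i) u) x)"
      by (subst sum.swap) (simp add: vf_apply_def[of ?T] sum_distrib_left)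
    finally show ?thesis
      by (simp add: vf_apply_def[of ?T u] sum_distrib_left) (simp add: dil_generator_def)
  qed
  have dS: "(\<lambda>y. (?p i y *\<^sub>R X i y) $ j) differentiable (at x)" for i j
    using P dX by (auto intro: differentiable_mult)
  have dS': "(\<lambda>y. (\<Sum>i\<in>UNIV. ?p i y *\<^sub>R X i y) $ j) differentiable (at x)" for j
    unfolding sum_component using dS by (auto intro: differentiable_sum)
  have "divergence (\<lambda>y. vf_apply ?T u y *\<^sub>R (\<Sum>i\<in>UNIV. ?p i y *\<^sub>R X i y)) x
      = (\<Sum>i\<in>UNIV. ?p i x * vf_apply (X i) (vf_apply ?T u) x)
        + vf_apply ?T u x * (\<Sum>i\<in>UNIV. vf_apply (X i) (?p i) x)"
    unfolding divergence_scaleR[OF dXu(2) dS'] vf_apply_sum_scaleR divergence_sum[OF dS]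
      divergence_scaleR[OF P dX(1)] divX by simp
  also have "(\<Sum>i\<in>UNIV. ?p i x * vf_apply (X i) (vf_apply ?T u) x)
      = (\<Sum>i\<in>UNIV. ?p i x * vf_apply ?T (vf_apply (X i) u) x)
        + grad_p F (X_jet X u x) \<bullet> X_grad X u x"
    unfolding dil_generator_commutator[OF U u x hom X]
    by (simp add: inner_vec_def grad_p_def X_grad_def sum.distrib algebra_simps)
  finally show ?thesis
    unfolding 1 2 by (simp add: X_div_def grad_p_def algebra_simps)
qed

theorem proposition3p2:
  fixes X :: "'m::finite \<Rightarrow> real^'n::{finite,linorder} \<Rightarrow> real^'n::{finite,linorder}"
    and \<sigma> :: "'n \<Rightarrow> nat"
    and \<Omega> :: "(real^'n::{finite,linorder}) set"
    and F :: "(real^'n::{finite,linorder}) \<times> real \<times> (real^'m) \<Rightarrow> real"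
    and u :: "real^'n::{finite,linorder} \<Rightarrow> real"
  assumes X_smooth: "\<And>i. smooth (X i)"
    and X_independent: "vf_independent X"
    and sigma_min: "\<sigma> (Min UNIV) = 1"
    and sigma_mono: "mono \<sigma>"
    and H1: "\<And>i. homogeneous_degree_one \<sigma> (X i)"
    and H2: "hoermander_at_0 X"
    and Omega_open: "open \<Omega>"
    and Omega_bounded: "bounded \<Omega>"
    and Omega_regular: "divergence_regular \<Omega>"
    and P1: "Ck_closure 1 (\<Omega> \<times> UNIV \<times> UNIV) F"
    and P2: "\<And>i. Ck_closure 1 (\<Omega> \<times> UNIV \<times> UNIV) (d_p i F)"
    and u_C2: "Ck_closure 2 \<Omega> u"
  shows
    "(LINT x:\<Omega>|lborel. real (\<Sum>k\<in>UNIV. \<sigma> k) * F (X_jet X u x)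
                          - grad_p F (X_jet X u x) \<bullet> X_grad X u x)
     + (LINT x:\<Omega>|lborel. \<Sum>i\<in>UNIV. real (\<sigma> i) * x $ i * d_x i F (X_jet X u x))
     + (LINT x:\<Omega>|lborel. vf_apply (dil_generator \<sigma>) u x *
                          (X_div X (\<lambda>y. grad_p F (X_jet X u y)) x + d_z F (X_jet X u x)))
     = (LINT x:frontier \<Omega>|surface_measure.
          F (X_jet X u x) * (dil_generator \<sigma> x \<bullet> outward_normal \<Omega> x))
     - (LINT x:frontier \<Omega>|surface_measure.
          vf_apply (dil_generator \<sigma>) u x * (grad_p F (X_jet X u x) \<bullet> X_normal X \<Omega> x))"
proof -
  let ?T = "dil_generator \<sigma>"
  obtain U where U: "open U" "closure \<Omega> \<subseteq> U" "Ck_on 2 U u"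
    using u_C2 by (auto simp: Ck_closure_def)
  have nbhd: "\<exists>W. open W \<and> closure \<Omega> \<times> UNIV \<subseteq> W \<and> Ck_on 1 W f"
    if "Ck_closure 1 (\<Omega> \<times> UNIV \<times> UNIV) f" for f :: "('n, 'm) lagrangian"
    using that by (simp del: One_nat_def add: Ck_closure_def closure_Times)
  obtain WF where WF: "open WF" "closure \<Omega> \<times> UNIV \<subseteq> WF" "Ck_on 1 WF F"
    using nbhd[OF P1] by blast
  obtain Wp where Wp: "\<And>i. open (Wp i)" "\<And>i. closure \<Omega> \<times> UNIV \<subseteq> Wp i"
      "\<And>i. Ck_on 1 (Wp i) (d_p i F)"
    using nbhd[OF P2] by metis
  \<comment> \<open>A priori every one of these \<open>C\<^sup>1\<close> functions has its own neighbourhood; \<open>W\<close> serves them all,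
    and \<open>N\<close> is a neighbourhood of the closure of \<open>\<Omega>\<close> whose jets stay in \<open>W\<close>.\<close>
  define W where "W = WF \<inter> (\<Inter>i. Wp i)"
  have W: "open W" "closure \<Omega> \<times> UNIV \<subseteq> W" "Ck_on 1 W F" "Ck_on 1 W (d_p i F)" for i
  proof -
    show "open W" unfolding W_def by (intro open_Int open_INT ballI finite WF(1) Wp(1))
    show "closure \<Omega> \<times> UNIV \<subseteq> W" unfolding W_def by (intro Int_greatest INT_greatest WF(2) Wp(2))
    show "Ck_on 1 W F" by (rule Ck_on_mono[OF WF(3)]) (simp add: W_def)
    show "Ck_on 1 W (d_p i F)" by (rule Ck_on_mono[OF Wp(3)]) (auto simp: W_def)
  qed
  have X: "Ck_on 1 S (X i)" for S i
    using X_smooth[of i] Ck_on_mono subset_UNIV unfolding smooth_def by blast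
  have T: "Ck_on 1 S ?T" for S
    unfolding Ck_on_1_vec_iff dil_generator_def by (simp del: One_nat_def add: Ck_on_const_mult_nth)
  have pos: "\<sigma> k \<ge> 1" for k
    using monoD[OF sigma_mono, of "Min UNIV" k] sigma_min by simp
  have "continuous_on U (X_jet X u)"
    unfolding X_jet_def X_grad_def
    by (intro continuous_intros continuous_on_vec_lambda Ck_on_imp_continuous[OF U(3)]
        Ck_on_imp_continuous[OF Ck_on_1_vf_apply[OF U(3) X]])
  define N where "N = U \<inter> X_jet X u -` W"
  have N: "open N" "closure \<Omega> \<subseteq> N" "Ck_on 2 N u" "N \<subseteq> U" "X_jet X u ` N \<subseteq> W"
  proof -
    show "open N"
      unfolding N_def by (rule continuous_open_preimage[OF \<open>continuous_on U (X_jet X u)\<close> U(1) W(1)])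
    have "X_jet X u x \<in> W" if "x \<in> closure \<Omega>" for x
      using W(2) that by (force simp: X_jet_def)
    then show "closure \<Omega> \<subseteq> N" using U(2) by (auto simp: N_def)
    show "Ck_on 2 N u" by (rule Ck_on_mono[OF U(3)]) (simp add: N_def)
  qed (auto simp: N_def)
  have cj: "continuous_on N (X_jet X u)"
    using \<open>continuous_on U (X_jet X u)\<close> N(4) by (rule continuous_on_subset)
  have Xu: "Ck_on 1 N (vf_apply (X i) u)" and Tu: "Ck_on 1 N (vf_apply ?T u)" for i
    by (rule Ck_on_1_vf_apply[OF N(3) X], rule Ck_on_1_vf_apply[OF N(3) T])
  have u1: "Ck_on 1 N u"
    by (rule Ck_on_Suc_imp) (use N(3) in \<open>simp only: Suc_1\<close>)
  have Fj: "Ck_on 1 N (\<lambda>y. F (X_jet X u y))" and pj: "Ck_on 1 N (\<lambda>y. d_p i F (X_jet X u y))" for i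
    by (rule Ck_on_1_jet[OF W(3) u1 Xu N(5) cj], rule Ck_on_1_jet[OF W(4) u1 Xu N(5) cj])
  \<comment> \<open>The flux is split into two fields of class \<open>C\<^sup>1\<close> and the divergence theorem is applied to each,
    so that no integrability on the boundary is needed to separate the two surface integrals.\<close>
  define V1 where "V1 = (\<lambda>y. F (X_jet X u y) *\<^sub>R ?T y)"
  define V2 where "V2 = (\<lambda>y. vf_apply ?T u y *\<^sub>R (\<Sum>i\<in>UNIV. d_p i F (X_jet X u y) *\<^sub>R X i y))"
  have Tj: "Ck_on 1 N (\<lambda>y. ?T y $ j)" and Xj: "Ck_on 1 N (\<lambda>y. X i y $ j)" for i j
    using T[of N] X[of N i] unfolding Ck_on_1_vec_iff by blast+
  have V1: "Ck_on 1 N V1"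
    unfolding V1_def Ck_on_1_vec_iff vector_scaleR_component real_scaleR_def
    by (intro allI Ck_on_1_mult Fj Tj)
  have V2: "Ck_on 1 N V2"
    unfolding V2_def Ck_on_1_vec_iff vector_scaleR_component real_scaleR_def sum_component
    by (intro allI Ck_on_1_mult Ck_on_1_sum finite Tu pj Xj)
  have flux: "(LINT x:\<Omega>|lborel. divergence V x)
      = (LINT x:frontier \<Omega>|surface_measure. V x \<bullet> outward_normal \<Omega> x)" if "Ck_on 1 N V" for V
  proof -
    have "Ck_closure 1 \<Omega> V" unfolding Ck_closure_def using that N(1,2) by blast
    then show ?thesis using Omega_regular unfolding divergence_regular_def by blast
  qed
  note int = set_integrable_continuous_closure[OF Omega_open Omega_bounded N(2)]
  note lag = Ck_on_1_lagrangian(2-4)[OF W(3), THEN continuous_on_compose2, OF cj N(5)]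
  note cont = Ck_on_imp_continuous[OF Fj] Ck_on_imp_continuous[OF pj] Ck_on_imp_continuous[OF Xu]
    Ck_on_imp_continuous[OF Tu] Ck_on_imp_continuous[OF X]
  let ?I1 = "\<lambda>x. real (\<Sum>k\<in>UNIV. \<sigma> k) * F (X_jet X u x) - grad_p F (X_jet X u x) \<bullet> X_grad X u x"
  let ?I2 = "\<lambda>x. \<Sum>i\<in>UNIV. real (\<sigma> i) * x $ i * d_x i F (X_jet X u x)"
  let ?I3 = "\<lambda>x. vf_apply ?T u x *
                 (X_div X (\<lambda>y. grad_p F (X_jet X u y)) x + d_z F (X_jet X u x))"
  have I1: "set_integrable lborel \<Omega> ?I1"
    unfolding inner_vec_def grad_p_def X_grad_def vec_lambda_beta
    by (intro int continuous_intros cont)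
  have I2: "set_integrable lborel \<Omega> ?I2"
    by (intro int continuous_intros lag)
  have "continuous_on N (partial k (\<lambda>y. d_p i F (X_jet X u y)))" for i k
    using pj[of i] unfolding Ck_on_1_iff by blast
  then have I3: "set_integrable lborel \<Omega> ?I3"
    unfolding X_div_def grad_p_def vec_lambda_beta vf_apply_def[of "X _"]
    by (intro int continuous_intros cont lag)
  have "(LINT x:\<Omega>|lborel. ?I1 x) + (LINT x:\<Omega>|lborel. ?I2 x) + (LINT x:\<Omega>|lborel. ?I3 x)
      = (LINT x:\<Omega>|lborel. ?I1 x + ?I2 x + ?I3 x)"
    using I1 I2 I3 by (simp add: set_integral_add)
  also have "\<dots> = (LINT x:\<Omega>|lborel. divergence V1 x - divergence V2 x)"
  proof (rule set_lebesgue_integral_cong)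
    show "\<Omega> \<in> sets lborel" using Omega_open by simp
    show "\<forall>x. x \<in> \<Omega> \<longrightarrow> ?I1 x + ?I2 x + ?I3 x = divergence V1 x - divergence V2 x"
    proof (intro allI impI)
      fix x assume "x \<in> \<Omega>"
      then have x: "x \<in> N" using N(2) closure_subset by blast
      have "F differentiable (at (X_jet X u x))"
        using Ck_on_1_lagrangian(1)[OF W(3)] N(5) x by blast
      moreover have "(\<lambda>y. d_p i F (X_jet X u y)) differentiable (at x)" for i
        using pj[of i] x unfolding Ck_on_1_iff by blast
      ultimately show "?I1 x + ?I2 x + ?I3 x = divergence V1 x - divergence V2 x"
        unfolding V1_def V2_def
        by (rule dilation_flux_divergence[OF N(1,3) x X H1 pos, symmetric])
    qed
  qed
  also have "\<dots> = (LINT x:\<Omega>|lborel. divergence V1 x) - (LINT x:\<Omega>|lborel. divergence V2 x)"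
    by (intro set_integral_diff int continuous_on_divergence V1 V2)
  also have "\<dots> = (LINT x:frontier \<Omega>|surface_measure. V1 x \<bullet> outward_normal \<Omega> x)
      - (LINT x:frontier \<Omega>|surface_measure. V2 x \<bullet> outward_normal \<Omega> x)"
    by (simp only: flux[OF V1] flux[OF V2])
  also have "(\<lambda>x. V1 x \<bullet> outward_normal \<Omega> x)
      = (\<lambda>x. F (X_jet X u x) * (?T x \<bullet> outward_normal \<Omega> x))"
    by (simp add: V1_def)
  also have "(\<lambda>x. V2 x \<bullet> outward_normal \<Omega> x)
      = (\<lambda>x. vf_apply ?T u x * (grad_p F (X_jet X u x) \<bullet> X_normal X \<Omega> x))"
    by (simp add: V2_def inner_sum_left inner_vec_def[of "vec_lambda _"] grad_p_def X_normal_def)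
  finally show ?thesis .
qed

end
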